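(* For any graph $G\in\mathcal{A}_1$ and any graph $H$, $$\gamma(G\square H)\ \geq\ \left(\gamma(G)-\sqrt{\gamma(G)}\right)\gamma(H).$$
   Context: All graphs are finite, simple, connected and undirected. A set $S\subseteq V(G)$ dominates $G$ if its closed neighborhood $N[S]$ equals $V(G)$; the domination number $\gamma(G)$ is the minimum cardinality of a dominating set. The Cartesian product $G\square H$ has vertex set $V(G)\times V(H)$, with $(u_1,v_1)$ and $(u_2,v_2)$ adjacent iff either $v_1=v_2$ and $u_1u_2\in E(G)$, or $u_1=u_2$ and $v_1v_2\in E(H)$. The clique covering number $\theta(G)$ is the minimum number $k$ of sets in a partition $V(G)=V_1\cup\dots\cup V_k$ such that each induced subgraph $G[V_i]$ is complete. The classes $\mathcal{D}_n$, $n\ge 0$, are defined recursively. $\mathcal{D}_0$ is the class of graphs $G$ with $\theta(G)=\gamma(G)$. For a positive integer $n$, $\mathcal{D}_n$ is the class of graphs $G$ such that $\theta(G)=\gamma(G)+n$ and $G$ is not a spanning subgraph of any graph $F\in\mathcal{D}_m$ with $0\le m<n$ and $\gamma(F)=\gamma(G)$. For a non-negative integer $n$, $\mathcal{A}_n$ is the class of graphs $G$ such that $G$ is a spanning subgraph of some graph $F\in\mathcal{D}_n$ with $\gamma(G)=\gamma(F)$. *)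

theory Defs
  imports Complex_Main "HOL-Library.Disjoint_Sets" "Graph_Theory.Graph_Theory"
begin

text \<open>
  A finite simple undirected graph is a \<^locale>\<open>pair_graph\<close>: a finite loop-free digraph whose
  arcs are ordered pairs of vertices, with a symmetric arc set, so that the edge \<open>uv\<close> is
  represented by the two arcs \<open>(u,v)\<close> and \<open>(v,u)\<close>. The function \<^const>\<open>with_proj\<close> embeds this
  representation into the general digraphs of the library. The library's
  \<^const>\<open>connected\<close> excludes the graph without vertices.
\<close>

definition connected_graph :: "'a pair_pre_digraph \<Rightarrow> bool" where
  "connected_graph G \<longleftrightarrow> pair_graph G \<and> connected (with_proj G)"

definition closed_nbhd :: "'a pair_pre_digraph \<Rightarrow> 'a set \<Rightarrow> 'a set" where
  "closed_nbhd G S = S \<union> {v \<in> pverts G. \<exists>u\<in>S. (u, v) \<in> parcs G}"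

definition dominating_set :: "'a pair_pre_digraph \<Rightarrow> 'a set \<Rightarrow> bool" where
  "dominating_set G S \<longleftrightarrow> S \<subseteq> pverts G \<and> closed_nbhd G S = pverts G"

definition domination_number :: "'a pair_pre_digraph \<Rightarrow> nat" where
  "domination_number G = (LEAST k. \<exists>S. dominating_set G S \<and> card S = k)"

definition clique_partition :: "'a pair_pre_digraph \<Rightarrow> 'a set set \<Rightarrow> bool" where
  "clique_partition G P \<longleftrightarrow>
     partition_on (pverts G) P \<and> (\<forall>A\<in>P. complete_digraph (card A) (with_proj G \<restriction> A))"

definition clique_covering_number :: "'a pair_pre_digraph \<Rightarrow> nat" where
  "clique_covering_number G = (LEAST k. \<exists>P. clique_partition G P \<and> card P = k)"

definition cartesian_product ::
  "'a pair_pre_digraph \<Rightarrow> 'b pair_pre_digraph \<Rightarrow> ('a \<times> 'b) pair_pre_digraph" where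
  "cartesian_product G H =
     \<lparr> pverts = pverts G \<times> pverts H,
       parcs = {((u1, v1), (u2, v2)) | u1 v1 u2 v2.
         (u1, v1) \<in> pverts G \<times> pverts H \<and> (u2, v2) \<in> pverts G \<times> pverts H \<and>
         (v1 = v2 \<and> (u1, u2) \<in> parcs G \<or> u1 = u2 \<and> (v1, v2) \<in> parcs H)} \<rparr>"

definition spanning_subgraph :: "'a pair_pre_digraph \<Rightarrow> 'a pair_pre_digraph \<Rightarrow> bool" where
  "spanning_subgraph G F \<longleftrightarrow> spanning (with_proj G) (with_proj F)"

text \<open>
  A spanning supergraph has the same vertex set, hence the same vertex type, so each class can be
  taken over a single vertex type.
\<close>

fun class_D :: "nat \<Rightarrow> 'a pair_pre_digraph set" where
  "class_D 0 = {G. connected_graph G \<and> clique_covering_number G = domination_number G}"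
| "class_D (Suc n) =
     {G. connected_graph G \<and> clique_covering_number G = domination_number G + Suc n \<and>
         \<not> (\<exists>m\<in>{..<Suc n}. \<exists>F\<in>class_D m.
               domination_number F = domination_number G \<and> spanning_subgraph G F)}"

definition class_A :: "nat \<Rightarrow> 'a pair_pre_digraph set" where
  "class_A n =
     {G. connected_graph G \<and>
         (\<exists>F\<in>class_D n. spanning_subgraph G F \<and> domination_number G = domination_number F)}"

end

(* Vizing-type argument in the style of Barcalkin and German. Put k = gamma(F), where F is a
   spanning supergraph of G with gamma(F) = gamma(G), partitioned into k + 1 cliques, and let D dominate F x H. For every vertex h of H
   let J h be the set of cliques A such that either D meets A x {h}, or D misses A x N[h]. The slice
   D_h of D dominates all cliques in J h, since in the second case the vertices of A x {h} can only be
   dominated horizontally; completing D_h by one vertex of every other clique gives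
   |J h| <= |D_h| + 1. Call h tight if equality holds. If two tight vertices had disjoint sets J h,
   the union of their slices could be completed to a dominating set of F with k - 1 vertices, so the
   sets J h of tight vertices pairwise intersect. Finally, for each clique A the vertices h with
   A in J h dominate H, so these incidences number at least gamma(H) for every clique.

   Let d be the least |D_h| over tight h. Discarding the d + 1 cliques of a minimising J h leaves no
   tight excess, so |D| >= (k - d) gamma(H). On the other hand there are at most |D| / d tight
   vertices, so |D| + |D| / d >= (k + 1) gamma(H). One of the two bounds suffices according to
   whether d <= sqrt k or not. *)

theory Submission
  imports Defs
begin

section \<open>Dominating sets and clique partitions of minimum size\<close>

lemma connected_graphD:
  assumes "connected_graph G"
  shows "finite (pverts G)" and "(u, v) \<in> parcs G \<Longrightarrow> u \<in> pverts G"
    and "(u, v) \<in> parcs G \<Longrightarrow> (v, u) \<in> parcs G"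
proof -
  interpret pair_graph G using assms by (simp add: connected_graph_def)
  show "finite (pverts G)" by (rule pair_finite_verts)
  show "(u, v) \<in> parcs G \<Longrightarrow> u \<in> pverts G" by (rule in_arcsD1)
  show "(u, v) \<in> parcs G \<Longrightarrow> (v, u) \<in> parcs G"
    using pair_sym_arcs by (auto simp: symmetric_def dest: symD)
qed

lemma domination_number_le_card:
  "dominating_set G S \<Longrightarrow> domination_number G \<le> card S"
  unfolding domination_number_def by (rule Least_le) blast

lemma dominating_set_pverts: "dominating_set G (pverts G)"
  by (auto simp: dominating_set_def closed_nbhd_def)

lemma obtain_min_dominating_set:
  obtains S where "dominating_set G S" "card S = domination_number G"
proof -
  have "\<exists>S. dominating_set G S \<and> card S = domination_number G"
    unfolding domination_number_def by (rule LeastI_ex) (use dominating_set_pverts in blast)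
  with that show thesis by blast
qed

lemma clique_partition_adjacent:
  assumes "clique_partition G P" "A \<in> P" "u \<in> A" "v \<in> A" "u \<noteq> v"
  shows "(u, v) \<in> parcs G"
proof -
  have "arcs_ends (with_proj G \<restriction> A) = {(u, v). (u, v) \<in> A \<times> A \<and> u \<noteq> v}"
    using assms(1,2) by (simp add: clique_partition_def complete_digraph_def)
  with assms(3-5) have "(u, v) \<in> arcs_ends (with_proj G \<restriction> A)" by simp
  then show ?thesis by (auto simp: arcs_ends_conv induce_subgraph_def)
qed

text \<open>Ensures that the \<open>LEAST\<close> in \<open>clique_covering_number\<close> ranges
  over a nonempty set, so that the minimum is attained.\<close>

lemma clique_partition_singletons:
  assumes "connected_graph G"
  shows "clique_partition G ((\<lambda>v. {v}) ` pverts G)"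
proof -
  interpret pair_graph G using assms by (simp add: connected_graph_def)
  have "complete_digraph (card {v}) (with_proj G \<restriction> {v})" if "v \<in> pverts G" for v
  proof -
    have [simp]: "{e \<in> parcs G. fst e = v \<and> snd e = v} = {}"
      using pair_no_loops by fastforce
    have "graph (with_proj G \<restriction> {v})"
      by unfold_locales
        (auto simp: induce_subgraph_def arc_to_ends_def symmetric_def arcs_ends_def)
    then show ?thesis
      by (auto simp: complete_digraph_def induce_subgraph_def arcs_ends_def)
  qed
  moreover have "partition_on (pverts G) ((\<lambda>v. {v}) ` pverts G)"
    by (auto simp: partition_on_def disjoint_def)
  ultimately show ?thesis by (auto simp: clique_partition_def)
qed

lemma obtain_min_clique_partition:
  assumes "connected_graph G"
  obtains P where "clique_partition G P" "card P = clique_covering_number G"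
proof -
  have "\<exists>P. clique_partition G P \<and> card P = clique_covering_number G"
    unfolding clique_covering_number_def
    by (rule LeastI_ex) (use clique_partition_singletons[OF assms] in blast)
  with that show thesis by blast
qed

section \<open>Dominating sets in supergraphs and from clique representatives\<close>

lemma dominating_set_cartesian_product_mono:
  assumes "pverts G = pverts F" "parcs G \<subseteq> parcs F" "dominating_set (cartesian_product G H) D"
  shows "dominating_set (cartesian_product F H) D"
proof -
  have "parcs (cartesian_product G H) \<subseteq> parcs (cartesian_product F H)"
    "pverts (cartesian_product G H) = pverts (cartesian_product F H)"
    using assms(1,2) by (auto simp: cartesian_product_def)
  with assms(3) show ?thesis by (fastforce simp: dominating_set_def closed_nbhd_def)
qed

text \<open>\<open>W\<close> takes care of the cliques in \<open>Q\<close>, and one representative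
  of each remaining clique dominates that clique; together they dominate \<open>F\<close>. It is
  applied to a single slice and to the union of two slices.\<close>

lemma domination_number_partial_clique_cover:
  assumes F: "connected_graph F" and P: "clique_partition F P"
    and W: "W \<subseteq> pverts F" and Q: "Q \<subseteq> P" "\<Union>Q \<subseteq> closed_nbhd F W"
  shows "domination_number F + card Q \<le> card W + card P"
proof -
  have part: "partition_on (pverts F) P" using P by (simp add: clique_partition_def)
  then have ne: "A \<noteq> {}" if "A \<in> P" for A
    using that by (auto simp: partition_on_def)
  have UP: "\<Union>P = pverts F" using part by (simp add: partition_on_def)
  have finP: "finite P" using part connected_graphD(1)[OF F] finite_elements by blast
  define r where "r A = (SOME v. v \<in> A)" for A :: "'a set"
  have r: "r A \<in> A" if "A \<in> P" for A
    unfolding r_def using ne[OF that] by (simp add: some_in_eq)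
  let ?S = "W \<union> r ` (P - Q)"
  have "v \<in> closed_nbhd F ?S" if v: "v \<in> pverts F" for v
  proof -
    obtain A where A: "A \<in> P" "v \<in> A" using v UP by blast
    show ?thesis
    proof (cases "A \<in> Q")
      case True
      with A(2) Q(2) show ?thesis by (auto simp: closed_nbhd_def)
    next
      case False
      have "v = r A \<or> (r A, v) \<in> parcs F"
        using clique_partition_adjacent[OF P A(1) r[OF A(1)] A(2)] by blast
      with False A(1) v show ?thesis by (auto simp: closed_nbhd_def)
    qed
  qed
  moreover have "?S \<subseteq> pverts F" using W r UP by blast
  ultimately have "dominating_set F ?S" by (auto simp: dominating_set_def closed_nbhd_def)
  then have "domination_number F \<le> card ?S" by (rule domination_number_le_card)
  also have "\<dots> \<le> card W + card (r ` (P - Q))" by (rule card_Un_le)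
  also have "card (r ` (P - Q)) \<le> card (P - Q)" using finP by (intro card_image_le) simp
  also have "card (P - Q) = card P - card Q"
    using Q(1) finP by (simp add: card_Diff_subset finite_subset)
  \<comment> \<open>\<open>card Q \<le> card P\<close> makes the truncated subtraction a true
    one.\<close>
  finally show ?thesis using card_mono[OF finP Q(1)] by linarith
qed

section \<open>Counting incidences of an intersecting family\<close>

lemma sum_card_incidence:
  assumes "finite V" "finite I"
  shows "(\<Sum>h\<in>V. card (J h \<inter> I)) = (\<Sum>A\<in>I. card {h \<in> V. A \<in> J h})"
proof -
  have "(\<Sum>h\<in>V. card (J h \<inter> I)) = (\<Sum>h\<in>V. \<Sum>A\<in>I. of_bool (A \<in> J h))"
    using assms by (intro sum.cong) (auto simp: Int_commute sum_of_bool_eq Int_def)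
  also have "\<dots> = (\<Sum>A\<in>I. \<Sum>h\<in>V. of_bool (A \<in> J h))" by (rule sum.swap)
  also have "\<dots> = (\<Sum>A\<in>I. card {h \<in> V. A \<in> J h})"
    using assms by (intro sum.cong) (auto simp: sum_of_bool_eq Int_def)
  finally show ?thesis .
qed

text \<open>The counting argument without graphs: \<open>V\<close> stands for the vertices of H,
  \<open>P\<close> for the cliques, \<open>w h\<close> for the slice sizes and \<open>g\<close> for
  the domination number of H.\<close>

lemma intersecting_excess_bound:
  fixes J :: "'h \<Rightarrow> 'c set" and w :: "'h \<Rightarrow> nat" and g k :: nat
  assumes fin: "finite V" "finite P" and cardP: "card P = k + 1"
    and sub: "\<And>h. h \<in> V \<Longrightarrow> J h \<subseteq> P"
    and le: "\<And>h. h \<in> V \<Longrightarrow> card (J h) \<le> w h + 1"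
    and pos: "\<And>h. h \<in> V \<Longrightarrow> card (J h) = w h + 1 \<Longrightarrow> w h > 0"
    and inter: "\<And>h h'. h \<in> V \<Longrightarrow> h' \<in> V \<Longrightarrow> card (J h) = w h + 1 \<Longrightarrow> card (J h') = w h' + 1
                  \<Longrightarrow> J h \<inter> J h' \<noteq> {}"
    and cover: "\<And>A. A \<in> P \<Longrightarrow> g \<le> card {h \<in> V. A \<in> J h}"
  shows "(real k - sqrt (real k)) * real g \<le> real (\<Sum>h\<in>V. w h)"
proof -
  define T where "T = {h \<in> V. card (J h) = w h + 1}"
  have lower: "card I * g \<le> (\<Sum>h\<in>V. card (J h \<inter> I))" if "I \<subseteq> P" for I
  proof -
    have "(\<Sum>A\<in>I. g) \<le> (\<Sum>A\<in>I. card {h \<in> V. A \<in> J h})"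
      using cover that by (intro sum_mono) blast
    then show ?thesis
      using sum_card_incidence[OF fin(1) finite_subset[OF that fin(2)], of J] by simp
  qed
  have finJ: "finite (J h)" if "h \<in> V" for h using sub[OF that] fin(2) by (rule finite_subset)
  \<comment> \<open>All incidences are counted: each clique contributes at least \<open>g\<close>,
    each \<open>h\<close> at most \<open>w h\<close>, plus 1 if it is tight.\<close>
  have full: "real (k + 1) * real g \<le> real (\<Sum>h\<in>V. w h) + real (card T)"
  proof -
    have "(k + 1) * g \<le> (\<Sum>h\<in>V. card (J h \<inter> P))" using lower[of P] cardP by simp
    also have "\<dots> \<le> (\<Sum>h\<in>V. w h + of_bool (h \<in> T))"
    proof (rule sum_mono)
      fix h assume h: "h \<in> V"
      have "J h \<inter> P = J h" using sub[OF h] by blast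
      then show "card (J h \<inter> P) \<le> w h + of_bool (h \<in> T)"
        using le[OF h] h by (auto simp: T_def)
    qed
    also have "\<dots> = (\<Sum>h\<in>V. w h) + card T"
      using fin(1) by (simp add: sum.distrib sum_of_bool_eq) (simp add: T_def Int_def)
    finally show ?thesis by (metis of_nat_add of_nat_le_iff of_nat_mult)
  qed
  show ?thesis
  proof (cases "T = {}")
    case True
    have "(real k - sqrt (real k)) * real g \<le> real (k + 1) * real g"
      by (intro mult_right_mono) (auto intro: order_trans[of _ 0])
    with full True show ?thesis by simp
  next
    case False
    define h0 where "h0 = arg_min_on w T"
    define d where "d = w h0"
    have finT: "finite T" using fin(1) by (simp add: T_def)
    have h0: "h0 \<in> T" unfolding h0_def by (rule arg_min_if_finite(1)[OF finT False])
    have dmin: "d \<le> w h" if "h \<in> T" for h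
      unfolding d_def h0_def using arg_min_least[OF finT False that] .
    have dpos: "d > 0" using pos h0 by (auto simp: T_def d_def)
    show ?thesis
    proof (cases "real d \<le> sqrt (real k)")
      case True
      have J0: "J h0 \<subseteq> P" "card (J h0) = d + 1" using h0 sub by (auto simp: T_def d_def)
      have "card (P - J h0) + (d + 1) = k + 1"
        using J0 cardP card_mono[OF fin(2) J0(1)] fin(2)
        by (simp add: card_Diff_subset finite_subset)
      then have cd: "card (P - J h0) + d = k" by simp
      have "card (P - J h0) * g \<le> (\<Sum>h\<in>V. card (J h \<inter> (P - J h0)))" by (rule lower) simp
      also have "\<dots> \<le> (\<Sum>h\<in>V. w h)"
      proof (rule sum_mono)
        fix h assume h: "h \<in> V"
        \<comment> \<open>A tight \<open>h\<close> loses a clique shared with \<open>J h0\<close>,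
          which cancels its excess of 1; any other \<open>h\<close> has no excess.\<close>
        show "card (J h \<inter> (P - J h0)) \<le> w h"
        proof (cases "h \<in> T")
          case True
          then have "J h \<inter> J h0 \<noteq> {}" using h0 inter by (auto simp: T_def)
          then have "J h \<inter> (P - J h0) \<subset> J h" by blast
          from psubset_card_mono[OF finJ[OF h] this] le[OF h] show ?thesis by simp
        next
          case False
          have "card (J h \<inter> (P - J h0)) \<le> card (J h)" by (rule card_mono[OF finJ[OF h]]) blast
          with False le[OF h] h show ?thesis by (auto simp: T_def)
        qed
      qed
      finally have "real (card (P - J h0)) * real g \<le> real (\<Sum>h\<in>V. w h)"
        by (metis of_nat_le_iff of_nat_mult)
      moreover have "real k - sqrt (real k) \<le> real (card (P - J h0))" using cd True by linarith
      ultimately show ?thesis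
        by (meson mult_right_mono of_nat_0_le_iff order_trans)
    next
      case False
      define D where "D = real (\<Sum>h\<in>V. w h)"
      define s where "s = sqrt (real k)"
      have s: "s \<ge> 0" "real k = s * s" "s \<le> real d" using False by (auto simp: s_def)
      \<comment> \<open>Each tight vertex has weight at least \<open>d\<close>, which bounds their
        number; \<open>d\<close> is then lowered to \<open>s\<close>.\<close>
      have "card T * d = (\<Sum>h\<in>T. d)" by simp
      also have "\<dots> \<le> (\<Sum>h\<in>T. w h)" using dmin by (rule sum_mono)
      also have "\<dots> \<le> (\<Sum>h\<in>V. w h)" using fin(1) by (intro sum_mono2) (auto simp: T_def)
      finally have "real (card T) * real d \<le> D"
        unfolding D_def by (metis of_nat_le_iff of_nat_mult)
      then have "real (card T) * s \<le> D" using s(3)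
        by (meson mult_left_mono of_nat_0_le_iff order_trans)
      moreover have "(s * s + 1) * real g * s \<le> (D + real (card T)) * s"
        using full s by (intro mult_right_mono) (auto simp: D_def add.commute)
      ultimately have "(s * s + 1) * real g * s \<le> D * (s + 1)" by (simp add: algebra_simps)
      \<comment> \<open>The left factor is \<open>s^3 - s\<close>, the right one
        \<open>s^3 + s\<close>; afterwards the positive factor \<open>s + 1\<close> cancels.\<close>
      moreover have "(s * s - s) * real g * (s + 1) \<le> (s * s + 1) * real g * s"
        using s(1) by (simp add: algebra_simps)
      ultimately have "(s * s - s) * real g * (s + 1) \<le> D * (s + 1)" by linarith
      then have "(s * s - s) * real g \<le> D" using s(1) by (simp add: mult_le_cancel_right)
      then show ?thesis by (simp add: D_def s_def)
    qed
  qed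
qed

section \<open>Slices of a dominating set of the product\<close>

lemma domination_number_product_clique_partition:
  assumes F: "connected_graph F" and H: "connected_graph H" and P: "clique_partition F P"
    and cardP: "card P = domination_number F + 1" and D: "dominating_set (cartesian_product F H) D"
  shows "(real (domination_number F) - sqrt (real (domination_number F)))
           * real (domination_number H) \<le> real (card D)"
proof -
  define N where "N h = closed_nbhd H {h}" for h
  define J where "J h = {A \<in> P. (\<exists>v\<in>A. (v, h) \<in> D) \<or> (\<forall>v\<in>A. \<forall>h'\<in>N h. (v, h') \<notin> D)}" for h
  define S where "S h = {v. (v, h) \<in> D}" for h
  have part: "partition_on (pverts F) P" using P by (simp add: clique_partition_def)
  have UP: "\<Union>P = pverts F" using part by (simp add: partition_on_def)
  have nemp: "A \<noteq> {}" if "A \<in> P" for A using that part by (auto simp: partition_on_def)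
  have finP: "finite P" using part connected_graphD(1)[OF F] finite_elements by blast
  have Dsub: "D \<subseteq> pverts F \<times> pverts H"
    using D by (auto simp: dominating_set_def cartesian_product_def)
  have finV: "finite (pverts H)" by (rule connected_graphD(1)[OF H])
  have Ssub: "S h \<subseteq> pverts F" for h using Dsub by (auto simp: S_def)
  have finS: "finite (S h)" for h using Ssub connected_graphD(1)[OF F] by (rule finite_subset)
  have dom: "\<exists>u h'. (u, h') \<in> D \<and> ((u, h') = (v, h) \<or> h' = h \<and> (u, v) \<in> parcs F
                \<or> u = v \<and> (h', h) \<in> parcs H)"
    if "v \<in> pverts F" "h \<in> pverts H" for v h
  proof -
    have "(v, h) \<in> closed_nbhd (cartesian_product F H) D"
      using D that by (auto simp: dominating_set_def cartesian_product_def)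
    then show ?thesis by (auto simp: closed_nbhd_def cartesian_product_def)
  qed
  have Ndom: "\<Union>(J h) \<subseteq> closed_nbhd F (S h)" if h: "h \<in> pverts H" for h
  proof
    fix v assume "v \<in> \<Union>(J h)"
    then obtain A where A: "A \<in> J h" "v \<in> A" by blast
    then have AP: "A \<in> P" and v: "v \<in> pverts F" using UP by (auto simp: J_def)
    show "v \<in> closed_nbhd F (S h)"
    proof (cases "\<exists>u\<in>A. (u, h) \<in> D")
      case True
      then obtain u where u: "u \<in> A" "(u, h) \<in> D" by blast
      with clique_partition_adjacent[OF P AP u(1) A(2)] v show ?thesis
        by (auto simp: closed_nbhd_def S_def)
    next
      case False
      with A have miss: "\<And>h'. h' \<in> N h \<Longrightarrow> (v, h') \<notin> D" by (auto simp: J_def)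
      \<comment> \<open>\<open>N h\<close> is built from arcs leaving \<open>h\<close>, while
        \<open>dom\<close> provides an arc into \<open>h\<close>; symmetry reconciles them. Hence no
        vertex \<open>(v, h')\<close> can dominate \<open>(v, h)\<close>, and the dominator lies in
        the slice at \<open>h\<close>.\<close>
      have "h' \<in> N h" if "(h', h) \<in> parcs H" for h'
        using connected_graphD(2,3)[OF H] that by (auto simp: N_def closed_nbhd_def)
      with dom[OF v h] miss v show ?thesis by (auto simp: closed_nbhd_def S_def N_def)
    qed
  qed
  have JP: "J h \<subseteq> P" for h by (auto simp: J_def)
  have "(real (domination_number F) - sqrt (real (domination_number F)))
         * real (domination_number H) \<le> real (\<Sum>h\<in>pverts H. card (S h))"
  proof (rule intersecting_excess_bound[OF finV finP cardP JP])
    fix h assume h: "h \<in> pverts H"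
    from domination_number_partial_clique_cover[OF F P Ssub JP Ndom[OF h]]
    show "card (J h) \<le> card (S h) + 1" using cardP by simp
  next
    fix h assume h: "h \<in> pverts H" and tight: "card (J h) = card (S h) + 1"
    \<comment> \<open>Tightness forces a nonempty clique into \<open>J h\<close>, and an empty slice
      could not dominate it.\<close>
    have "J h \<noteq> {}" using tight by auto
    then obtain A where "A \<in> J h" "A \<noteq> {}" using nemp JP by blast
    then have "closed_nbhd F (S h) \<noteq> {}" using Ndom[OF h] by blast
    then have "S h \<noteq> {}" by (auto simp: closed_nbhd_def)
    then show "card (S h) > 0" using finS by (simp add: card_gt_0_iff)
  next
    fix h h' assume h: "h \<in> pverts H" "h' \<in> pverts H"
      and tight: "card (J h) = card (S h) + 1" "card (J h') = card (S h') + 1"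
    show "J h \<inter> J h' \<noteq> {}"
    proof
      assume disj: "J h \<inter> J h' = {}"
      \<comment> \<open>The two excesses add up to 2, whereas \<open>P\<close> exceeds the
        domination number by only 1.\<close>
      have "\<Union>(J h \<union> J h') \<subseteq> closed_nbhd F (S h \<union> S h')"
        using Ndom[OF h(1)] Ndom[OF h(2)] by (fastforce simp: closed_nbhd_def)
      then have "domination_number F + card (J h \<union> J h') \<le> card (S h \<union> S h') + card P"
        using Ssub JP by (intro domination_number_partial_clique_cover[OF F P]) auto
      moreover have "card (J h \<union> J h') = card (J h) + card (J h')"
        using disj finite_subset[OF JP finP] by (intro card_Un_disjoint) auto
      moreover have "card (S h \<union> S h') \<le> card (S h) + card (S h')" by (rule card_Un_le)
      ultimately show False using tight cardP by linarith
    qed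
  next
    fix A assume A: "A \<in> P"
    let ?B = "{h \<in> pverts H. A \<in> J h}"
    \<comment> \<open>If \<open>A\<close> is not in \<open>J h\<close>, then \<open>D\<close> meets
      \<open>A\<close> in some layer \<open>h'\<close> with \<open>h' \<in> N h\<close>; meeting
      \<open>D\<close> there puts \<open>A\<close> into \<open>J h'\<close>, so \<open>h'\<close> is
      a neighbour of \<open>h\<close> in \<open>?B\<close>.\<close>
    have "h \<in> closed_nbhd H ?B" if h: "h \<in> pverts H" for h
    proof (cases "A \<in> J h")
      case True
      with h show ?thesis by (simp add: closed_nbhd_def)
    next
      case False
      then obtain v h' where vh: "v \<in> A" "h' \<in> N h" "(v, h') \<in> D" using A by (auto simp: J_def)
      then have "h' \<in> ?B" using A Dsub by (auto simp: J_def)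
      moreover have "h' = h \<or> (h', h) \<in> parcs H"
        using vh(2) connected_graphD(3)[OF H] by (auto simp: N_def closed_nbhd_def)
      ultimately show ?thesis using h unfolding closed_nbhd_def by blast
    qed
    then have "dominating_set H ?B" by (auto simp: dominating_set_def closed_nbhd_def)
    then show "domination_number H \<le> card ?B" by (rule domination_number_le_card)
  qed
  also have "(\<Sum>h\<in>pverts H. card (S h)) = card D"
  proof -
    \<comment> \<open>Slices are indexed by the second coordinate, so pairs are swapped to obtain a
      dependent sum.\<close>
    have "D = prod.swap ` (SIGMA h:pverts H. S h)" using Dsub by (force simp: S_def)
    then have "card D = card (SIGMA h:pverts H. S h)" by (metis card_image inj_swap)
    then show ?thesis using finV finS by simp
  qed
  finally show ?thesis .
qed

section \<open>Transfer from the spanning supergraph\<close>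

theorem theorem2p11:
  fixes G :: "'a pair_pre_digraph" and H :: "'b pair_pre_digraph"
  assumes "G \<in> class_A 1" and "connected_graph H"
  shows "real (domination_number (cartesian_product G H))
           \<ge> (real (domination_number G) - sqrt (real (domination_number G)))
              * real (domination_number H)"
proof -
  obtain F where F: "F \<in> class_D 1" "spanning_subgraph G F"
    "domination_number G = domination_number F"
    using assms(1) by (auto simp: class_A_def)
  have cF: "connected_graph F" and theta: "clique_covering_number F = domination_number F + 1"
    using F(1) by (auto simp: One_nat_def simp del: class_D.simps(1))
  have GF: "pverts G = pverts F" "parcs G \<subseteq> parcs F"
    using F(2) by (auto simp: spanning_subgraph_def spanning_def subgraph_def)
  obtain P where P: "clique_partition F P" "card P = domination_number F + 1"
    using obtain_min_clique_partition[OF cF] theta by metis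
  obtain D where D: "dominating_set (cartesian_product G H) D"
    "card D = domination_number (cartesian_product G H)"
    by (rule obtain_min_dominating_set)
  \<comment> \<open>A minimum dominating set of the product with \<open>G\<close> also dominates the
    product with \<open>F\<close>, and \<open>G\<close> and \<open>F\<close> have equal domination
    numbers.\<close>
  from domination_number_product_clique_partition[OF cF assms(2) P
      dominating_set_cartesian_product_mono[OF GF D(1)]]
  show ?thesis using D(2) F(3) by simp
qed

end
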